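(* Suppose that $l_*\in\{2,3,\dots\}$, $d_*:=\frac{2l_*}{l_*-1}$, $\beta_*:=2^{\frac{2-d_*}{2d_*}}$. For $d:=d_*-\epsilon$ and $\beta:=2^{\frac{2-d}{2d}}$ consider the $\epsilon$-expansion $$\beta^{-2l}=\beta_*^{-2l}\sum_{m=0}^\infty(\beta^{-2l})^{(m)}\epsilon^m ,$$ which defines the numbers $(\beta^{-2l})^{(m)}$. Suppose that $z=\sum_{m=0}^\infty z_mu_m$ is a fixed point, i.e. $z=z\times_\beta z$. This is equivalent to $\mathcal S_{\beta^{-1}}(z)=z\times_1z$, where $\mathcal S_{\beta^{-1}}$ is the linear operator defined by $\mathcal S_{\beta^{-1}}(u_m)=\beta^{-2m}u_m$ for all $m\in\mathbb N$. Consider the $\epsilon$-expansion $$z=u_0+\sum_{k=1}^\infty\epsilon^k z^{(k)} .$$ Let $T$ be the linear operator $T(x):=x-2u_0\times_{\beta_*}x$. Then $$z^{(1)}\in\ker T=\{\lambda u_{l_*}:\lambda\in\mathbb C\}=:\mathcal B_{l_*}.$$ Let $P_{l_*}:\mathcal B\to\mathcal B$ be the projection operator with $P_{l_*}(\mathcal B)=\mathcal B_{l_*}$ (annihilating $u_m$ for $m\ne l_*$). Consider the $\epsilon$-expansion $$\mathcal S_{\beta^{-1}}=\sum_{m=0}^\infty\epsilon^m\,\mathcal S_{\beta_*^{-1}}\circ\mathcal S^{(m)}_{\beta^{-1}},$$ where the linear operator $\mathcal S^{(m)}_{\beta^{-1}}:\mathcal B\to\mathcal B$ is defined by $\mathcal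 S^{(m)}_{\beta^{-1}}(u_l)=(\beta^{-2l})^{(m)}u_l$. Then $$z^{(1)}=\alpha u_{l_*},\qquad \alpha:=\frac{2(\beta^{-2l_*})^{(1)}}{\mathcal C_{l_*}^{l_*l_*}},$$ and $$(1-P_{l_*})(z^{(k)})=T^{-1}\sum_{m=1}^{k-1}\Big[-\mathcal S^{(k-m)}_{\beta^{-1}}\big((1-P_{l_*})(z^{(m)})\big)+(1-P_{l_*})\big(z^{(k-m)}\times_{\beta_*}z^{(m)}\big)\Big],$$ and for $k\ge2$ $$P_{l_*}(z^{(k)})=\frac1{(\beta^{-2l_*})^{(1)}}\Big[\sum_{m=1}^{k-1}(\beta^{-2l_*})^{(k+1-m)}P_{l_*}(z^{(m)})-\sum_{m=2}^{k-1}P_{l_*}\big(z^{(k+1-m)}\times_{\beta_*}z^{(m)}\big)+2P_{l_*}\big(z^{(1)}\times_{\beta_*}(1-P_{l_*})(z^{(k)})\big)\Big].$$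
   Context: $\mathcal B$ is the complex algebra with basis $u_0,u_1,u_2,\dots$ and, for a parameter $b$, bilinear commutative product $$u_m\times_bu_n=\sum_{|m-n|\le l\le m+n}b^{2l}\,\mathcal C_l^{mn}\,u_l,\qquad \mathcal C_l^{mn}:=\frac{(2m)!\,(2n)!}{(m+n-l)!\,(l+n-m)!\,(l+m-n)!}.$$ Expansions in $\epsilon$ are expansions in powers of $\epsilon$ with coefficients $z^{(k)}\in\mathcal B$, compared order by order. $T^{-1}$ denotes the inverse of $T$ on $(1-P_{l_*})(\mathcal B)$, where $T$ acts diagonally by $T(u_l)=(1-2\beta_*^{2l})u_l$. $\mathcal S_{\beta_*^{-1}}(u_m)=\beta_*^{-2m}u_m$.
   Formalization: The last term of the formula for P(z^(k)) is taken with sign minus (−2P(z^(1)×(1−P)z^(k))), as the plus sign is false; z^(1)=αu_{l*} is asserted only when z is not the trivial fixed point u_0, for which it fails. *)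

theory Defs
  imports
    "HOL-Complex_Analysis.Complex_Analysis"
    "HOL-Library.Poly_Mapping"
begin

text \<open>
  The complex vector space with basis \<open>u\<^sub>0, u\<^sub>1, \<dots>\<close>, as finitely supported coefficient
  functions. The convolution product that \<^theory>\<open>HOL-Library.Poly_Mapping\<close> puts on this type is
  not the algebra product used here.
\<close>

type_synonym balg = "nat \<Rightarrow>\<^sub>0 complex"

definition bvec :: "nat \<Rightarrow> balg" where
  "bvec l = Poly_Mapping.single l 1"

definition scal :: "complex \<Rightarrow> balg \<Rightarrow> balg" where
  "scal c x = Poly_Mapping.map ((*) c) x"

definition diag_op :: "(nat \<Rightarrow> complex) \<Rightarrow> balg \<Rightarrow> balg" where
  "diag_op w x = (\<Sum>l\<in>Poly_Mapping.keys x. scal (w l * Poly_Mapping.lookup x l) (bvec l))"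

text \<open>Only used for \<open>\<bar>m - n\<bar> \<le> l \<le> m + n\<close>, where no subtraction truncates.\<close>

definition struct_const :: "nat \<Rightarrow> nat \<Rightarrow> nat \<Rightarrow> complex" where
  "struct_const l m n =
     fact (2 * m) * fact (2 * n) / (fact (m + n - l) * fact (l + n - m) * fact (l + m - n))"

text \<open>
  The bilinear product with a general weight \<open>w l\<close> in place of \<open>b\<^sup>2\<^sup>l\<close>. The weights are a parameter
  because the Taylor coefficients in \<open>\<epsilon>\<close> of \<open>b(\<epsilon>)\<^sup>2\<^sup>l\<close> are also needed as weights.
\<close>

definition weighted_prod :: "(nat \<Rightarrow> complex) \<Rightarrow> balg \<Rightarrow> balg \<Rightarrow> balg" where
  "weighted_prod w x y =
     (\<Sum>m\<in>Poly_Mapping.keys x. \<Sum>n\<in>Poly_Mapping.keys y.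
        scal (Poly_Mapping.lookup x m * Poly_Mapping.lookup y n)
          (\<Sum>l = nat \<bar>int m - int n\<bar>..m + n. scal (w l * struct_const l m n) (bvec l)))"

definition bprod :: "complex \<Rightarrow> balg \<Rightarrow> balg \<Rightarrow> balg" where
  "bprod b = weighted_prod (\<lambda>l. b ^ (2 * l))"

definition scale_op :: "complex \<Rightarrow> balg \<Rightarrow> balg" where
  "scale_op b = diag_op (\<lambda>l. b ^ (2 * l))"

text \<open>
  An expansion \<open>\<Sum>\<^sub>k \<epsilon>\<^sup>k x\<^sup>(\<^sup>k\<^sup>)\<close> with coefficients in the algebra is the sequence \<open>k \<mapsto> x\<^sup>(\<^sup>k\<^sup>)\<close>.
  For a parameter \<open>b\<close> depending analytically on \<open>\<epsilon>\<close> near 0, the product and the scaling operator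
  act on expansions by expanding the matrix entries \<open>b(\<epsilon>)\<^sup>2\<^sup>l\<close> in \<open>\<epsilon>\<close> and collecting
  equal powers of \<open>\<epsilon>\<close>.
\<close>

definition eps_coeff :: "(complex \<Rightarrow> complex) \<Rightarrow> nat \<Rightarrow> complex" where
  "eps_coeff f m = fps_nth (fps_expansion f 0) m"

definition scale_op_coeff :: "(complex \<Rightarrow> complex) \<Rightarrow> nat \<Rightarrow> balg \<Rightarrow> balg" where
  "scale_op_coeff b m = diag_op (\<lambda>l. eps_coeff (\<lambda>\<epsilon>. b \<epsilon> ^ (2 * l)) m)"

definition bprod_coeff :: "(complex \<Rightarrow> complex) \<Rightarrow> nat \<Rightarrow> balg \<Rightarrow> balg \<Rightarrow> balg" where
  "bprod_coeff b m = weighted_prod (\<lambda>l. eps_coeff (\<lambda>\<epsilon>. b \<epsilon> ^ (2 * l)) m)"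

definition eps_scale_op :: "(complex \<Rightarrow> complex) \<Rightarrow> (nat \<Rightarrow> balg) \<Rightarrow> nat \<Rightarrow> balg" where
  "eps_scale_op b x = (\<lambda>k. \<Sum>m\<le>k. scale_op_coeff b m (x (k - m)))"

definition eps_bprod :: "(complex \<Rightarrow> complex) \<Rightarrow> (nat \<Rightarrow> balg) \<Rightarrow> (nat \<Rightarrow> balg) \<Rightarrow> nat \<Rightarrow> balg" where
  "eps_bprod b x y = (\<lambda>k. \<Sum>m\<le>k. \<Sum>i\<le>k - m. bprod_coeff b m (x i) (y (k - m - i)))"

definition d_star :: "nat \<Rightarrow> complex" where
  "d_star ls = 2 * of_nat ls / (of_nat ls - 1)"

definition beta_of :: "complex \<Rightarrow> complex" where
  "beta_of d = 2 powr ((2 - d) / (2 * d))"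

definition beta_star :: "nat \<Rightarrow> complex" where
  "beta_star ls = beta_of (d_star ls)"

definition beta_eps :: "nat \<Rightarrow> complex \<Rightarrow> complex" where
  "beta_eps ls \<epsilon> = beta_of (d_star ls - \<epsilon>)"

text \<open>The numbers \<open>(\<beta>\<^sup>-\<^sup>2\<^sup>l)\<^sup>(\<^sup>m\<^sup>)\<close>, normalised by the factor \<open>\<beta>\<^sub>*\<^sup>-\<^sup>2\<^sup>l\<close>, and the
  operators having them as eigenvalues.\<close>

definition beta_coeff :: "nat \<Rightarrow> nat \<Rightarrow> nat \<Rightarrow> complex" where
  "beta_coeff ls l m =
     eps_coeff (\<lambda>\<epsilon>. inverse (beta_eps ls \<epsilon>) ^ (2 * l) / inverse (beta_star ls) ^ (2 * l)) m"

definition S_coeff :: "nat \<Rightarrow> nat \<Rightarrow> balg \<Rightarrow> balg" where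
  "S_coeff ls m = diag_op (\<lambda>l. beta_coeff ls l m)"

definition T_op :: "nat \<Rightarrow> balg \<Rightarrow> balg" where
  "T_op ls x = x - bprod (beta_star ls) (scal 2 (bvec 0)) x"

definition P_op :: "nat \<Rightarrow> balg \<Rightarrow> balg" where
  "P_op ls x = scal (Poly_Mapping.lookup x ls) (bvec ls)"

definition Q_op :: "nat \<Rightarrow> balg \<Rightarrow> balg" where
  "Q_op ls x = x - P_op ls x"

definition T_inv :: "nat \<Rightarrow> balg \<Rightarrow> balg" where
  "T_inv ls = the_inv_into (range (Q_op ls)) (T_op ls)"

end

theory Submission
  imports Defs
begin

text \<open>
  Read in the \<open>u\<^sub>l\<close>-coordinate, the fixed point equation says that two power series in \<open>\<epsilon>\<close>
  differ by the factor \<open>\<beta>\<^sup>2\<^sup>l\<close>, a unit. Inverting it and comparing coefficients gives, in order \<open>k\<close>,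
  \<open>T z\<^sup>(\<^sup>k\<^sup>)\<close> in terms of lower orders, because \<open>z\<^sup>(\<^sup>0\<^sup>) = u\<^sub>0\<close> is the unit of the product up to scaling.
  The eigenvalue \<open>1 - 2 \<beta>\<^sub>*\<^sup>2\<^sup>l = 1 - 2 powr (1 - l/l\<^sub>*)\<close> of \<open>T\<close> vanishes only for \<open>l = l\<^sub>*\<close>, so away from
  \<open>u\<^bsub>l*\<^esub>\<close> the equation is solved by \<open>T\<^sup>-\<^sup>1\<close>, while its \<open>u\<^bsub>l*\<^esub>\<close>-component in order \<open>k + 1\<close> is a solvability
  condition. For \<open>k = 1\<close> this is a quadratic equation for \<open>z\<^sup>(\<^sup>1\<^sup>)\<close>, and for \<open>k \<ge> 2\<close> a linear one for
  \<open>P z\<^sup>(\<^sup>k\<^sup>)\<close>, with a nonzero coefficient since \<open>\<beta>\<^sup>-\<^sup>2\<^sup>l\<close> has nonzero derivative in \<open>\<epsilon>\<close> at \<open>l = l\<^sub>*\<close>.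
\<close>

section \<open>Coordinates of the diagonal operators and projections\<close>

abbreviation coord :: "balg \<Rightarrow> nat \<Rightarrow> complex" where
  "coord \<equiv> Poly_Mapping.lookup"

lemma coord_scal [simp]: "coord (scal c x) l = c * coord x l"
  by (simp add: scal_def Poly_Mapping.map.rep_eq when_def)

lemma coord_bvec: "coord (bvec m) l = (if l = m then 1 else 0)"
  by (simp add: bvec_def lookup_single when_def)

lemma keys_bvec: "Poly_Mapping.keys (bvec m) = {m}"
  by (simp add: bvec_def)

lemma keys_scal: "Poly_Mapping.keys (scal c x) \<subseteq> Poly_Mapping.keys x"
  by (auto simp: in_keys_iff)

lemma coord_diag_op [simp]: "coord (diag_op w x) l = w l * coord x l"
proof -
  have "coord (diag_op w x) l =
      (\<Sum>m\<in>Poly_Mapping.keys x. if m = l then w m * coord x m else 0)"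
    unfolding diag_op_def lookup_sum by (intro sum.cong) (auto simp: coord_bvec)
  also have "\<dots> = w l * coord x l"
    by (simp add: in_keys_iff)
  finally show ?thesis .
qed

lemma coord_P_op [simp]: "coord (P_op ls x) l = (if l = ls then coord x ls else 0)"
  by (simp add: P_op_def coord_bvec)

lemma coord_Q_op [simp]: "coord (Q_op ls x) l = (if l = ls then 0 else coord x l)"
  by (simp add: Q_op_def lookup_minus)

lemma range_Q_op: "range (Q_op ls) = {x. coord x ls = 0}"
proof -
  have "x = Q_op ls x" if "coord x ls = 0" for x
    using that by (intro poly_mapping_eqI) auto
  then show ?thesis by auto
qed

section \<open>Structure constants and the product in coordinates\<close>

text \<open>Extension by zero moves the triangle condition into the coefficient, so that product
  sums run over rectangles of index pairs.\<close>

definition basis_coeff :: "nat \<Rightarrow> nat \<Rightarrow> nat \<Rightarrow> complex" where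
  "basis_coeff l m n = (if l \<in> {nat \<bar>int m - int n\<bar>..m + n} then struct_const l m n else 0)"

lemma basis_coeff_commute: "basis_coeff l m n = basis_coeff l n m"
proof -
  have "{nat \<bar>int m - int n\<bar>..m + n} = {nat \<bar>int n - int m\<bar>..n + m}"
    by (metis abs_minus_commute add.commute)
  moreover have "struct_const l m n = struct_const l n m"
    unfolding struct_const_def by (simp only: add.commute[of m n] mult_ac)
  ultimately show ?thesis
    unfolding basis_coeff_def by (simp only:)
qed

text \<open>Coefficients vanish off the supports. Arbitrary finite supersets are allowed so that
  several factors share one index set, and so that \<open>scal c (bvec l)\<close> can be summed over
  \<open>{l}\<close> even if \<open>c = 0\<close>.\<close>

lemma coord_weighted_prod:
  assumes "finite A" "finite B" "Poly_Mapping.keys x \<subseteq> A" "Poly_Mapping.keys y \<subseteq> B"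
  shows "coord (weighted_prod w x y) l =
    w l * (\<Sum>m\<in>A. \<Sum>n\<in>B. coord x m * coord y n * basis_coeff l m n)"
proof -
  have inner: "coord (\<Sum>l = nat \<bar>int m - int n\<bar>..m + n. scal (w l * struct_const l m n) (bvec l)) l
      = w l * basis_coeff l m n" for m n
  proof -
    have "coord (\<Sum>l = nat \<bar>int m - int n\<bar>..m + n. scal (w l * struct_const l m n) (bvec l)) l
      = (\<Sum>j = nat \<bar>int m - int n\<bar>..m + n. if j = l then w j * struct_const j m n else 0)"
      unfolding lookup_sum by (intro sum.cong) (auto simp: coord_bvec)
    also have "\<dots> = (if l \<in> {nat \<bar>int m - int n\<bar>..m + n} then w l * struct_const l m n else 0)"
      by (rule sum.delta) (rule finite_atLeastAtMost)
    finally show ?thesis unfolding basis_coeff_def by (simp only: if_distrib mult_zero_right)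
  qed
  have "coord (weighted_prod w x y) l =
    (\<Sum>m\<in>Poly_Mapping.keys x. \<Sum>n\<in>Poly_Mapping.keys y.
       coord x m * coord y n * (w l * basis_coeff l m n))"
    unfolding weighted_prod_def lookup_sum coord_scal inner[unfolded lookup_sum coord_scal] ..
  also have "\<dots> = (\<Sum>m\<in>A. \<Sum>n\<in>B. coord x m * coord y n * (w l * basis_coeff l m n))"
  proof -
    have "(\<Sum>n\<in>Poly_Mapping.keys y. coord x m * coord y n * (w l * basis_coeff l m n)) =
        (\<Sum>n\<in>B. coord x m * coord y n * (w l * basis_coeff l m n))" for m
      using assms by (intro sum.mono_neutral_left) (auto simp: in_keys_iff)
    then show ?thesis
      using assms by (simp, intro sum.mono_neutral_left) (auto simp: in_keys_iff)
  qed
  finally show ?thesis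
    by (simp add: sum_distrib_left mult_ac)
qed

lemma coord_bprod:
  assumes "finite A" "finite B" "Poly_Mapping.keys x \<subseteq> A" "Poly_Mapping.keys y \<subseteq> B"
  shows "coord (bprod b x y) l =
    b ^ (2 * l) * (\<Sum>m\<in>A. \<Sum>n\<in>B. coord x m * coord y n * basis_coeff l m n)"
  unfolding bprod_def using assms by (rule coord_weighted_prod)

text \<open>The weight depends only on the output index \<open>l\<close>, so it leaves the double
  sum; all dependence on the parameter is this one factor.\<close>

lemma weighted_prod_eq_bprod_1:
  "coord (weighted_prod w x y) l = w l * coord (bprod 1 x y) l"
  by (simp add: coord_weighted_prod[OF finite_keys finite_keys order_refl order_refl]
      coord_bprod[OF finite_keys finite_keys order_refl order_refl])

lemma bprod_eq_bprod_1: "coord (bprod b x y) l = b ^ (2 * l) * coord (bprod 1 x y) l"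
  unfolding bprod_def[of b] by (rule weighted_prod_eq_bprod_1)

lemma bprod_commute: "bprod b x y = bprod b y x"
proof (rule poly_mapping_eqI)
  fix l
  show "coord (bprod b x y) l = coord (bprod b y x) l"
    unfolding coord_bprod[OF finite_keys finite_keys order_refl order_refl]
    by (subst sum.swap) (simp add: basis_coeff_commute mult_ac)
qed

lemma bprod_add_right: "bprod b x (y + y') = bprod b x y + bprod b x y'"
proof (rule poly_mapping_eqI)
  fix l
  let ?B = "Poly_Mapping.keys y \<union> Poly_Mapping.keys y'"
  have sub: "Poly_Mapping.keys (y + y') \<subseteq> ?B"
    by (auto simp: in_keys_iff lookup_add)
  have "coord (bprod b x v) l = b ^ (2 * l) *
      (\<Sum>m\<in>Poly_Mapping.keys x. \<Sum>n\<in>?B. coord x m * coord v n * basis_coeff l m n)"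
    if "Poly_Mapping.keys v \<subseteq> ?B" for v
    by (rule coord_bprod) (use that in auto)
  from this[OF sub] this[OF Un_upper1] this[OF Un_upper2]
  show "coord (bprod b x (y + y')) l = coord (bprod b x y + bprod b x y') l"
    by (simp add: lookup_add sum.distrib ring_distribs)
qed

text \<open>For \<open>m = 0\<close> the triangle condition leaves only \<open>l = n\<close>; hence
  multiplication by \<open>bvec 0\<close> is diagonal.\<close>

lemma basis_coeff_0_left: "basis_coeff l 0 n = (if l = n then 1 else 0)"
  by (auto simp: basis_coeff_def struct_const_def mult_2)

lemma coord_bprod_bvec_0: "coord (bprod b (scal c (bvec 0)) x) l = c * b ^ (2 * l) * coord x l"
proof -
  have "coord (bprod b (scal c (bvec 0)) x) l = b ^ (2 * l) *
     (\<Sum>m\<in>{0}. \<Sum>n\<in>Poly_Mapping.keys x. coord (scal c (bvec 0)) m * coord x n * basis_coeff l m n)"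
    by (rule coord_bprod) (use keys_scal[of c "bvec 0"] in \<open>auto simp: keys_bvec\<close>)
  also have "\<dots> = b ^ (2 * l) *
     (\<Sum>n\<in>Poly_Mapping.keys x. if n = l then c * coord x n else 0)"
    by (simp add: coord_bvec basis_coeff_0_left if_distrib[of "\<lambda>t. _ * t"] eq_commute[of l] cong: if_cong)
  also have "\<dots> = c * b ^ (2 * l) * coord x l"
    by (simp add: in_keys_iff)
  finally show ?thesis .
qed

lemma bprod_bvec_0: "coord (bprod b (bvec 0) x) l = b ^ (2 * l) * coord x l"
proof -
  have "scal 1 (bvec 0) = bvec 0"
    by (rule poly_mapping_eqI) simp
  then show ?thesis
    using coord_bprod_bvec_0[of b 1 x l] by simp
qed

lemma coord_bprod_bvec_diag:
  "coord (bprod b (scal c (bvec l)) (scal d (bvec l))) l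
     = c * d * b ^ (2 * l) * struct_const l l l"
proof -
  have "coord (bprod b (scal c (bvec l)) (scal d (bvec l))) l = b ^ (2 * l) *
     (\<Sum>m\<in>{l}. \<Sum>n\<in>{l}. coord (scal c (bvec l)) m * coord (scal d (bvec l)) n * basis_coeff l m n)"
    using keys_scal[of c "bvec l"] keys_scal[of d "bvec l"]
    by (intro coord_bprod) (auto simp: keys_bvec)
  then show ?thesis
    by (simp add: coord_bvec basis_coeff_def)
qed

section \<open>Expansions in \<epsilon> as formal power series\<close>

lemma eps_coeff_eq: "f has_fps_expansion F \<Longrightarrow> eps_coeff f m = fps_nth F m"
  by (simp add: eps_coeff_def fps_expansion_eqI)

lemma has_fps_expansion_eps_coeff: "f analytic_on {0} \<Longrightarrow> f has_fps_expansion Abs_fps (eps_coeff f)"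
proof -
  have "Abs_fps (eps_coeff f) = fps_expansion f 0"
    by (simp add: fps_eq_iff eps_coeff_def)
  then show "f analytic_on {0} \<Longrightarrow> f has_fps_expansion Abs_fps (eps_coeff f)"
    using analytic_at_imp_has_fps_expansion_0[of f] by simp
qed

text \<open>Fixing \<open>l\<close> turns an expansion with values in the algebra into a scalar
  power series, where the weight is a single factor that can be inverted.\<close>

definition coord_fps :: "(nat \<Rightarrow> balg) \<Rightarrow> nat \<Rightarrow> complex fps" where
  "coord_fps y l = Abs_fps (\<lambda>k. coord (y k) l)"

lemma coord_fps_eqI: "(\<And>l. coord_fps x l = coord_fps y l) \<Longrightarrow> x = y"
  by (rule ext, rule poly_mapping_eqI) (auto simp: coord_fps_def fps_eq_iff)

definition conv_fps :: "(nat \<Rightarrow> balg) \<Rightarrow> (nat \<Rightarrow> balg) \<Rightarrow> nat \<Rightarrow> complex fps" where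
  "conv_fps x y l = Abs_fps (\<lambda>k. \<Sum>i\<le>k. coord (bprod 1 (x i) (y (k - i))) l)"

lemma coord_fps_eps_bprod:
  "coord_fps (eps_bprod b x y) l = fps_expansion (\<lambda>\<epsilon>. b \<epsilon> ^ (2 * l)) 0 * conv_fps x y l"
  by (simp add: fps_eq_iff coord_fps_def conv_fps_def eps_bprod_def fps_mult_nth lookup_sum
      bprod_coeff_def weighted_prod_eq_bprod_1 eps_coeff_def sum_distrib_left atLeast0AtMost)

lemma coord_fps_eps_scale_op:
  "coord_fps (eps_scale_op b x) l = fps_expansion (\<lambda>\<epsilon>. b \<epsilon> ^ (2 * l)) 0 * coord_fps x l"
  by (simp add: fps_eq_iff coord_fps_def eps_scale_op_def fps_mult_nth lookup_sum
      scale_op_coeff_def eps_coeff_def atLeast0AtMost)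

text \<open>In coordinate \<open>l\<close> the fixed point equation is an identity of scalar series
  with factor \<open>E l\<close>, and \<open>E' l\<close> is the inverse of that factor.\<close>

lemma eps_fixed_point_iff:
  assumes an: "\<And>l. (\<lambda>\<epsilon>. b \<epsilon> ^ (2 * l)) analytic_on {0}" and nz: "\<And>\<epsilon>. b \<epsilon> \<noteq> 0"
  shows "y = eps_bprod b y y \<longleftrightarrow>
    eps_scale_op (\<lambda>\<epsilon>. inverse (b \<epsilon>)) y = eps_bprod (\<lambda>_. 1) y y"
proof -
  define E where "E l = fps_expansion (\<lambda>\<epsilon>. b \<epsilon> ^ (2 * l)) 0" for l
  define E' where "E' l = fps_expansion (\<lambda>\<epsilon>. inverse (b \<epsilon>) ^ (2 * l)) 0" for l
  \<comment> \<open>The product of the two functions is constantly 1, and expansions are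
    unique.\<close>
  have inv: "E l * E' l = 1" for l
  proof -
    have E: "(\<lambda>\<epsilon>. b \<epsilon> ^ (2 * l)) has_fps_expansion E l"
      unfolding E_def by (rule analytic_at_imp_has_fps_expansion_0[OF an])
    have E': "(\<lambda>\<epsilon>. inverse (b \<epsilon>) ^ (2 * l)) has_fps_expansion E' l"
      unfolding E'_def power_inverse
      by (intro analytic_at_imp_has_fps_expansion_0 analytic_on_inverse an) (auto simp: nz)
    have "(\<lambda>\<epsilon>. b \<epsilon> ^ (2 * l) * inverse (b \<epsilon>) ^ (2 * l)) has_fps_expansion E l * E' l"
      by (intro has_fps_expansion_mult E E')
    also have "(\<lambda>\<epsilon>. b \<epsilon> ^ (2 * l) * inverse (b \<epsilon>) ^ (2 * l)) = (\<lambda>_. 1)"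
      by (simp add: nz power_inverse)
    finally show ?thesis
      using fps_expansion_unique_complex has_fps_expansion_1 by blast
  qed
  have one: "fps_expansion (\<lambda>_. 1 ^ (2 * l)) 0 = (1 :: complex fps)" for l
    by (rule fps_expansion_eqI) simp
  have "y = eps_bprod b y y \<longleftrightarrow> (\<forall>l. coord_fps y l = E l * conv_fps y y l)"
    using coord_fps_eps_bprod[of b y y] unfolding E_def by (metis coord_fps_eqI)
  also have "\<dots> \<longleftrightarrow> (\<forall>l. E' l * coord_fps y l = conv_fps y y l)"
  proof (intro all_cong1)
    fix l
    have "E' l * (E l * x) = x" "E l * (E' l * x) = x" for x
      using inv[of l] by (metis mult.left_commute mult.right_neutral mult.commute)+
    then show "coord_fps y l = E l * conv_fps y y l \<longleftrightarrow> E' l * coord_fps y l = conv_fps y y l"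
      by metis
  qed
  also have "\<dots> \<longleftrightarrow> eps_scale_op (\<lambda>\<epsilon>. inverse (b \<epsilon>)) y = eps_bprod (\<lambda>_. 1) y y"
    using coord_fps_eps_bprod[of "\<lambda>_. 1" y y] coord_fps_eps_scale_op[of "\<lambda>\<epsilon>. inverse (b \<epsilon>)" y]
    unfolding E'_def one by (metis coord_fps_eqI mult_1)
  finally show ?thesis .
qed

section \<open>The parameter \<beta> and the expansion of its powers\<close>

lemma beta_of_nonzero [simp]: "beta_of d \<noteq> 0"
  by (simp add: beta_of_def)

lemma d_star_nonzero: "2 \<le> ls \<Longrightarrow> d_star ls \<noteq> 0"
  by (auto simp: d_star_def)

lemma analytic_beta_eps:
  assumes "2 \<le> ls"
  shows "beta_eps ls analytic_on {0}"
  unfolding beta_eps_def beta_of_def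
  by (intro analytic_intros) (use d_star_nonzero[OF assms] in auto)

lemma analytic_inverse_beta_eps_power:
  assumes "2 \<le> ls"
  shows "(\<lambda>\<epsilon>. inverse (beta_eps ls \<epsilon>) ^ n) analytic_on {0}"
  by (intro analytic_intros analytic_beta_eps assms) (simp add: beta_eps_def)

lemma beta_eps_0: "beta_eps ls 0 = beta_star ls"
  by (simp add: beta_eps_def beta_star_def)

lemma beta_star_nonzero [simp]: "beta_star ls \<noteq> 0"
  by (simp add: beta_star_def)

lemma beta_eps_nonzero [simp]: "beta_eps ls \<epsilon> \<noteq> 0"
  by (simp add: beta_eps_def)

text \<open>The exponent of 2 is \<open>1 / d - 1 / 2\<close> at \<open>d = d_star ls\<close>, which
  is the real number \<open>- 1 / (2 * ls)\<close>; the complex power is thus a real one.\<close>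

lemma beta_star_power:
  assumes "2 \<le> ls"
  shows "beta_star ls ^ (2 * l) = of_real (2 powr (- real l / real ls))"
proof -
  have ex: "(2 - d_star ls) / (2 * d_star ls) = of_real (- 1 / (2 * real ls))"
  proof -
    have "of_nat ls \<noteq> (0::complex)" "of_nat ls - 1 \<noteq> (0::complex)"
      using assms by auto
    then show ?thesis
      by (simp add: d_star_def divide_simps)
  qed
  have "beta_star ls = of_real (2 powr (- 1 / (2 * real ls)))"
    unfolding beta_star_def beta_of_def ex using powr_of_real[of 2 "- 1 / (2 * real ls)"] by simp
  then have "beta_star ls ^ (2 * l) = of_real ((2 powr (- 1 / (2 * real ls))) ^ (2 * l))"
    by simp
  also have "(2 powr (- 1 / (2 * real ls))) ^ (2 * l) = 2 powr (- real l / real ls)"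
    by (simp add: powr_power)
  finally show ?thesis .
qed

lemma T_eigenvalue_zero_iff:
  assumes "2 \<le> ls"
  shows "1 - 2 * beta_star ls ^ (2 * l) = 0 \<longleftrightarrow> l = ls"
proof -
  have "2 * beta_star ls ^ (2 * l) = of_real (2 powr (1 - real l / real ls))"
    unfolding beta_star_power[OF assms] powr_diff by (simp add: powr_minus divide_inverse)
  then have "1 - 2 * beta_star ls ^ (2 * l) = 0 \<longleftrightarrow> 2 powr (1 - real l / real ls) = 1"
    by (metis eq_iff_diff_eq_0 of_real_1 of_real_eq_iff)
  also have "\<dots> \<longleftrightarrow> l = ls"
    using assms by (auto simp: powr_eq_one_iff_gen divide_simps)
  finally show ?thesis .
qed

lemma beta_coeff_expansion:
  assumes "2 \<le> ls"
  shows "(\<lambda>\<epsilon>. inverse (beta_eps ls \<epsilon>) ^ (2 * l) / inverse (beta_star ls) ^ (2 * l))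
    has_fps_expansion Abs_fps (beta_coeff ls l)"
  unfolding beta_coeff_def[abs_def]
  by (rule has_fps_expansion_eps_coeff, intro analytic_on_divide analytic_inverse_beta_eps_power assms) auto

lemma inverse_beta_eps_power_expansion:
  assumes "2 \<le> ls"
  shows "(\<lambda>\<epsilon>. inverse (beta_eps ls \<epsilon>) ^ (2 * l)) has_fps_expansion
    fps_const (inverse (beta_star ls) ^ (2 * l)) * Abs_fps (beta_coeff ls l)"
  using has_fps_expansion_mult[OF has_fps_expansion_const beta_coeff_expansion[OF assms],
      of "inverse (beta_star ls) ^ (2 * l)" l]
  by simp

lemma beta_coeff_0: "beta_coeff ls l 0 = 1"
  by (simp add: beta_coeff_def eps_coeff_def fps_expansion_def beta_eps_0)

text \<open>For \<open>l = 0\<close> the expanded function is constantly 1. Hence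
  \<open>z 0 = bvec 0\<close> contributes nothing to the linear side in positive orders.\<close>

lemma beta_coeff_0_left: "k \<ge> 1 \<Longrightarrow> beta_coeff ls 0 k = 0"
  using eps_coeff_eq[OF has_fps_expansion_1, of k] by (simp add: beta_coeff_def)

text \<open>Write the power as \<open>exp (g \<epsilon>)\<close>. Since the exponent of 2 in \<beta>
  is \<open>1 / (d - \<epsilon>) - 1 / 2\<close>, the derivative of \<open>g\<close> at 0 is
  \<open>- 2 * ls * Ln 2 / d^2\<close>, which is not 0.\<close>

lemma beta_coeff_1_nonzero:
  assumes "2 \<le> ls"
  shows "beta_coeff ls ls 1 \<noteq> 0"
proof -
  define d where "d = d_star ls"
  have d: "d \<noteq> 0" using d_star_nonzero[OF assms] by (simp add: d_def)
  define g where "g = (\<lambda>\<epsilon>. - (2 * of_nat ls) * ((2 - (d - \<epsilon>)) / (2 * (d - \<epsilon>)) * Ln 2))"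
  have eq: "inverse (beta_eps ls \<epsilon>) ^ (2 * ls) = exp (g \<epsilon>)" for \<epsilon>
  proof -
    define a where "a = (2 - (d - \<epsilon>)) / (2 * (d - \<epsilon>)) * Ln 2"
    have "beta_eps ls \<epsilon> = exp a"
      by (simp add: beta_eps_def beta_of_def powr_def a_def d_def)
    moreover have "exp (g \<epsilon>) = inverse (exp a ^ (2 * ls))"
      unfolding g_def a_def[symmetric] using exp_of_nat_mult[of "2 * ls" a] by (simp add: exp_minus)
    ultimately show ?thesis
      by (simp add: power_inverse)
  qed
  have "(g has_field_derivative - (2 * of_nat ls) * (Ln 2 / d\<^sup>2)) (at 0)"
    unfolding g_def
    by (auto intro!: derivative_eq_intros simp: d) (use d in \<open>simp add: field_simps power2_eq_square\<close>)
  then have "((\<lambda>\<epsilon>. exp (g \<epsilon>) / inverse (beta_star ls) ^ (2 * ls)) has_field_derivative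
      exp (g 0) * (- (2 * of_nat ls) * (Ln 2 / d\<^sup>2)) / inverse (beta_star ls) ^ (2 * ls)) (at 0)"
    by (auto intro!: derivative_eq_intros)
  then have "beta_coeff ls ls 1 =
      exp (g 0) * (- (2 * of_nat ls) * (Ln 2 / d\<^sup>2)) / inverse (beta_star ls) ^ (2 * ls)"
    unfolding beta_coeff_def eps_coeff_def fps_expansion_def eq by (simp add: DERIV_imp_deriv)
  moreover have "Ln 2 \<noteq> 0"
    using Ln_of_real[of 2] by simp
  ultimately show ?thesis
    using d assms by simp
qed

lemma scale_op_coeff_inverse_beta_eps:
  assumes "2 \<le> ls"
  shows "scale_op_coeff (\<lambda>\<epsilon>. inverse (beta_eps ls \<epsilon>)) m
    = scale_op (inverse (beta_star ls)) \<circ> S_coeff ls m"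
proof (rule ext, rule poly_mapping_eqI)
  fix x l
  show "coord (scale_op_coeff (\<lambda>\<epsilon>. inverse (beta_eps ls \<epsilon>)) m x) l
     = coord ((scale_op (inverse (beta_star ls)) \<circ> S_coeff ls m) x) l"
    using eps_coeff_eq[OF inverse_beta_eps_power_expansion[OF assms, of l], of m]
    by (simp add: scale_op_coeff_def scale_op_def S_coeff_def)
qed

section \<open>Kernel and inverse of the operator T\<close>

lemma coord_T_op: "coord (T_op ls x) l = (1 - 2 * beta_star ls ^ (2 * l)) * coord x l"
  by (simp add: T_op_def lookup_minus coord_bprod_bvec_0 algebra_simps)

lemma T_op_kernel:
  assumes "2 \<le> ls"
  shows "T_op ls x = 0 \<longleftrightarrow> x = scal (coord x ls) (bvec ls)"
proof
  assume "T_op ls x = 0"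
  then have "(1 - 2 * beta_star ls ^ (2 * l)) * coord x l = 0" for l
    by (metis coord_T_op lookup_zero)
  then have "coord x l = 0" if "l \<noteq> ls" for l
    using that T_eigenvalue_zero_iff[OF assms] mult_eq_0_iff by blast
  then show "x = scal (coord x ls) (bvec ls)"
    by (intro poly_mapping_eqI) (auto simp: coord_bvec)
next
  assume x: "x = scal (coord x ls) (bvec ls)"
  show "T_op ls x = 0"
  proof (rule poly_mapping_eqI)
    fix l
    show "coord (T_op ls x) l = coord 0 l"
      by (subst x) (use T_eigenvalue_zero_iff[OF assms, of l] in \<open>auto simp: coord_T_op coord_bvec\<close>)
  qed
qed

lemma bij_betw_T_op:
  assumes "2 \<le> ls"
  shows "bij_betw (T_op ls) (range (Q_op ls)) (range (Q_op ls))"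
proof -
  \<comment> \<open>The inverse has the reciprocal eigenvalues. At \<open>l = ls\<close> the entry
    is \<open>inverse 0 = 0\<close>, harmless because elements of the range have no component
    there.\<close>
  define R where "R = diag_op (\<lambda>l. inverse (1 - 2 * beta_star ls ^ (2 * l)))"
  have nz: "1 - 2 * beta_star ls ^ (2 * l) \<noteq> 0" if "l \<noteq> ls" for l
    using T_eigenvalue_zero_iff[OF assms, of l] that by simp
  have "R (T_op ls x) = x" "T_op ls (R x) = x" if "coord x ls = 0" for x
  proof -
    have "coord (R (T_op ls x)) l = coord x l \<and> coord (T_op ls (R x)) l = coord x l" for l
      using nz[of l] that by (cases "l = ls") (auto simp: R_def coord_T_op)
    then show "R (T_op ls x) = x" "T_op ls (R x) = x"
      by (auto intro: poly_mapping_eqI)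
  qed
  then show ?thesis
    unfolding range_Q_op by (intro bij_betw_byWitness[where f' = R]) (auto simp: coord_T_op R_def)
qed

lemma T_inv_T_op:
  assumes "2 \<le> ls" "x \<in> range (Q_op ls)"
  shows "T_inv ls (T_op ls x) = x"
  unfolding T_inv_def using assms bij_betw_T_op[OF assms(1)]
  by (intro the_inv_into_f_f) (auto simp: bij_betw_def)

section \<open>Comparison of orders in the fixed point equation\<close>

lemma struct_const_diag_nonzero: "struct_const l l l \<noteq> 0"
  by (simp add: struct_const_def)

text \<open>The end terms of an order \<open>k\<close> sum are those containing \<open>z 0\<close>
  or \<open>z k\<close>; the rest involves only orders strictly between.\<close>

lemma sum_atMost_split_ends:
  fixes f :: "nat \<Rightarrow> 'a :: comm_monoid_add"
  assumes "k \<ge> 1"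
  shows "(\<Sum>i\<le>k. f i) = f 0 + f k + (\<Sum>i = 1..k - 1. f i)"
proof -
  have "{..k} = insert 0 (insert k {1..k - 1})"
    using assms by auto
  then show ?thesis
    using assms by (simp add: add.assoc)
qed

locale eps_fixed_point =
  fixes ls :: nat and z :: "nat \<Rightarrow> balg"
  assumes ls: "2 \<le> ls"
    and z0: "z 0 = bvec 0"
    and fixed_point: "z = eps_bprod (beta_eps ls) z z"
begin

text \<open>This is the coefficient of order \<open>k\<close> in the inverted equation, multiplied
  by \<open>beta_star ls ^ (2 * l)\<close>: the factor cancels the normalisation on the left and
  turns the product at 1 into the one at \<open>beta_star ls\<close> on the right.\<close>

lemma order_equation:
  "(\<Sum>m\<le>k. beta_coeff ls l (k - m) * coord (z m) l)
     = (\<Sum>m\<le>k. coord (bprod (beta_star ls) (z (k - m)) (z m)) l)"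
proof -
  have swap: "coord (bprod (beta_star ls) (z (k - m)) (z m)) l =
      beta_star ls ^ (2 * l) * coord (bprod 1 (z m) (z (k - m))) l" for m
    by (subst bprod_commute) (rule bprod_eq_bprod_1)
  have "eps_scale_op (\<lambda>\<epsilon>. inverse (beta_eps ls \<epsilon>)) z = eps_bprod (\<lambda>_. 1) z z"
    using fixed_point by (subst eps_fixed_point_iff[symmetric])
      (auto intro!: analytic_intros analytic_beta_eps ls)
  then have "coord_fps (eps_scale_op (\<lambda>\<epsilon>. inverse (beta_eps ls \<epsilon>)) z) l
      = coord_fps (eps_bprod (\<lambda>_. 1) z z) l"
    by simp
  moreover have "fps_expansion (\<lambda>_. 1 ^ (2 * l)) 0 = (1 :: complex fps)"
    by (rule fps_expansion_eqI) simp
  ultimately have "fps_const (inverse (beta_star ls) ^ (2 * l)) * Abs_fps (beta_coeff ls l) * coord_fps z l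
      = conv_fps z z l"
    using fps_expansion_eqI[OF inverse_beta_eps_power_expansion[OF ls, of l]]
    by (simp add: coord_fps_eps_scale_op coord_fps_eps_bprod)
  then have "fps_const (inverse (beta_star ls) ^ (2 * l)) * (coord_fps z l * Abs_fps (beta_coeff ls l))
      = conv_fps z z l"
    by (simp only: mult_ac)
  then have "inverse (beta_star ls) ^ (2 * l) * fps_nth (coord_fps z l * Abs_fps (beta_coeff ls l)) k
      = fps_nth (conv_fps z z l) k"
    by (metis fps_mult_left_const_nth)
  then have "fps_nth (coord_fps z l * Abs_fps (beta_coeff ls l)) k
      = beta_star ls ^ (2 * l) * fps_nth (conv_fps z z l) k"
    by (simp add: field_simps)
  then have "(\<Sum>m\<le>k. coord (z m) l * beta_coeff ls l (k - m))
      = (\<Sum>m\<le>k. beta_star ls ^ (2 * l) * coord (bprod 1 (z m) (z (k - m))) l)"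
    by (simp add: fps_mult_nth coord_fps_def conv_fps_def atLeast0AtMost sum_distrib_left)
  then show ?thesis
    by (simp only: swap mult.commute[of "beta_coeff _ _ _"])
qed

text \<open>The two end products are both \<open>z k\<close> times \<open>bvec 0\<close>; moved to
  the left they complete \<open>z k\<close> to \<open>T_op ls (z k)\<close>.\<close>

lemma coord_T_op_z:
  assumes "k \<ge> 1"
  shows "coord (T_op ls (z k)) l = (\<Sum>m = 1..k - 1. - (beta_coeff ls l (k - m) * coord (z m) l)
      + coord (bprod (beta_star ls) (z (k - m)) (z m)) l)"
proof -
  have rearrange: "A - C = - B + D" if "A + B = C + D" for A B C D :: complex
    using that by (simp add: algebra_simps)
  have z0_term: "beta_coeff ls l k * coord (bvec 0) l = 0"
    using beta_coeff_0_left[OF assms] by (simp add: coord_bvec)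
  have "coord (z k) l + (\<Sum>m = 1..k - 1. beta_coeff ls l (k - m) * coord (z m) l) =
     2 * beta_star ls ^ (2 * l) * coord (z k) l
      + (\<Sum>m = 1..k - 1. coord (bprod (beta_star ls) (z (k - m)) (z m)) l)"
    using order_equation[of l k] assms z0_term
    by (simp add: sum_atMost_split_ends z0 beta_coeff_0 bprod_bvec_0
        bprod_commute[of "beta_star ls" "z k" "bvec 0"])
  then show ?thesis
    unfolding coord_T_op sum.distrib sum_negf left_diff_distrib mult_1 by (rule rearrange)
qed

text \<open>In order 1 the sum over intermediate orders is empty.\<close>

lemma T_op_z1: "T_op ls (z 1) = 0"
  by (rule poly_mapping_eqI) (simp add: coord_T_op_z)

text \<open>T annihilates the coordinate \<open>ls\<close>, so the right side of the equation of
  order \<open>k + 1\<close> must vanish there.\<close>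

lemma solvability:
  assumes "k \<ge> 1"
  shows "(\<Sum>m = 1..k. beta_coeff ls ls (k + 1 - m) * coord (z m) ls)
    = (\<Sum>m = 1..k. coord (bprod (beta_star ls) (z (k + 1 - m)) (z m)) ls)"
proof -
  have "coord (T_op ls (z (k + 1))) ls = 0"
    using T_eigenvalue_zero_iff[OF ls, of ls] by (simp add: coord_T_op)
  moreover have "k + 1 \<ge> 1" "k + 1 - 1 = k"
    by simp_all
  ultimately have "(\<Sum>m = 1..k. - (beta_coeff ls ls (k + 1 - m) * coord (z m) ls)
      + coord (bprod (beta_star ls) (z (k + 1 - m)) (z m)) ls) = 0"
    using coord_T_op_z[of "k + 1" ls] by (simp only:)
  then show ?thesis
    unfolding sum.distrib sum_negf by (simp only: add.commute add_uminus_conv_diff right_minus_eq)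
qed

lemma z1_eq: "z 1 = scal (coord (z 1) ls) (bvec ls)"
  using T_op_z1 T_op_kernel[OF ls] by blast

text \<open>
  If \<open>j \<ge> 2\<close> is the first order with \<open>z j \<noteq> 0\<close>, then \<open>z j\<close> is in the kernel of \<open>T\<close> and the solvability
  condition of order \<open>j + 1\<close>, in which all products vanish, kills it.
\<close>

lemma z1_nonzero:
  assumes "\<exists>k\<ge>1. z k \<noteq> 0"
  shows "z 1 \<noteq> 0"
proof
  assume z1: "z 1 = 0"
  define j where "j = (LEAST k. k \<ge> 1 \<and> z k \<noteq> 0)"
  have j: "j \<ge> 1" "z j \<noteq> 0"
    using assms LeastI_ex[of "\<lambda>k. k \<ge> 1 \<and> z k \<noteq> 0"] by (auto simp: j_def)
  have below: "z m = 0" if "1 \<le> m" "m < j" for m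
    using that not_less_Least[of m "\<lambda>k. k \<ge> 1 \<and> z k \<noteq> 0"] by (auto simp: j_def)
  have bprod_0: "bprod b 0 x = 0" "bprod b x 0 = 0" for b x
    by (auto simp: bprod_def weighted_prod_def)
  have "T_op ls (z j) = 0"
    by (rule poly_mapping_eqI) (use j below in \<open>auto simp: coord_T_op_z bprod_0 intro!: sum.neutral\<close>)
  then have "coord (z j) ls \<noteq> 0"
    using T_op_kernel[OF ls, of "z j"] j(2) by (metis coord_scal mult_zero_left lookup_zero poly_mapping_eqI)
  moreover have "(\<Sum>m = 1..j. beta_coeff ls ls (j + 1 - m) * coord (z m) ls)
      = beta_coeff ls ls 1 * coord (z j) ls"
  proof -
    have "{1..j} = insert j {1..<j}" using j by auto
    moreover have "(\<Sum>m = 1..<j. beta_coeff ls ls (j + 1 - m) * coord (z m) ls) = 0"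
      by (intro sum.neutral) (auto simp: below)
    ultimately show ?thesis by simp
  qed
  moreover have "(\<Sum>m = 1..j. coord (bprod (beta_star ls) (z (j + 1 - m)) (z m)) ls) = 0"
  proof (intro sum.neutral ballI)
    fix m assume m: "m \<in> {1..j}"
    \<comment> \<open>For \<open>m = j\<close> the partner is \<open>z 1\<close>, which is 0 by
      assumption; smaller \<open>m\<close> lie below the first nonzero order.\<close>
    then have "z m = 0 \<or> z (j + 1 - m) = 0"
      using below[of m] z1 by (cases "m = j") auto
    then show "coord (bprod (beta_star ls) (z (j + 1 - m)) (z m)) ls = 0"
      by (auto simp: bprod_0)
  qed
  ultimately show False
    using solvability[OF j(1)] beta_coeff_1_nonzero[OF ls] by (metis mult_eq_0_iff)
qed

text \<open>The factor 1/2 is the weight at the resonance, where the eigenvalue of T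
  vanishes.\<close>

lemma coord_bprod_kernel:
  "coord (bprod (beta_star ls) (scal c (bvec ls)) (scal d (bvec ls))) ls
     = c * d * struct_const ls ls ls / 2"
proof -
  have "beta_star ls ^ (2 * ls) = 1 / 2"
  proof -
    have "2 * x = 1 \<Longrightarrow> x = 1 / 2" for x :: complex
      by (simp add: eq_divide_eq mult.commute)
    moreover have "2 * beta_star ls ^ (2 * ls) = 1"
      using T_eigenvalue_zero_iff[OF ls, of ls] by simp
    ultimately show ?thesis .
  qed
  then show ?thesis
    by (simp add: coord_bprod_bvec_diag)
qed

text \<open>The solvability condition for \<open>k = 1\<close> is quadratic in this coordinate, with
  the stated value and 0 as its roots. The root 0 belongs to the constant expansion
  \<open>bvec 0\<close>, itself a fixed point, which the hypothesis excludes.\<close>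

lemma coord_z1:
  assumes "\<exists>k\<ge>1. z k \<noteq> 0"
  shows "coord (z 1) ls = 2 * beta_coeff ls ls 1 / struct_const ls ls ls"
proof -
  define a where "a = coord (z 1) ls"
  have z1: "z 1 = scal a (bvec ls)"
    unfolding a_def by (rule z1_eq)
  have "a \<noteq> 0"
    using z1_nonzero[OF assms] z1 by (auto intro: poly_mapping_eqI)
  moreover have "beta_coeff ls ls 1 * a = a * a * struct_const ls ls ls / 2"
    using solvability[of 1] coord_bprod_kernel[of a a] by (simp add: z1[unfolded One_nat_def] coord_bvec)
  ultimately have "beta_coeff ls ls 1 = a * struct_const ls ls ls / 2"
    by (simp add: field_simps)
  then have "a = 2 * beta_coeff ls ls 1 / struct_const ls ls ls"
    using struct_const_diag_nonzero[of ls] by (simp add: eq_divide_eq mult.commute)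
  then show ?thesis
    by (simp only: a_def)
qed

section \<open>Recursion for the two components in higher orders\<close>

text \<open>All linear operators involved are diagonal, so removing the coordinate \<open>ls\<close>
  from the equation for \<open>T_op ls (z k)\<close> leaves an equation in the range where T is
  invertible.\<close>

lemma Q_op_z:
  assumes "k \<ge> 1"
  shows "Q_op ls (z k) = T_inv ls (\<Sum>m = 1..k - 1.
      - S_coeff ls (k - m) (Q_op ls (z m)) + Q_op ls (bprod (beta_star ls) (z (k - m)) (z m)))"
proof -
  have "T_op ls (Q_op ls (z k)) = (\<Sum>m = 1..k - 1.
      - S_coeff ls (k - m) (Q_op ls (z m)) + Q_op ls (bprod (beta_star ls) (z (k - m)) (z m)))"
    (is "?L = ?R")
  proof (rule poly_mapping_eqI)
    fix l
    have "coord ?L l = (if l = ls then 0 else coord (T_op ls (z k)) l)"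
      by (simp add: coord_T_op)
    also have "\<dots> = coord ?R l"
      by (simp add: coord_T_op_z[OF assms] lookup_sum lookup_add lookup_minus S_coeff_def)
    finally show "coord ?L l = coord ?R l" .
  qed
  then show ?thesis
    using T_inv_T_op[OF ls, of "Q_op ls (z k)"] by simp
qed

text \<open>
  The resonant component of \<open>z k\<close> enters the equation of order \<open>k + 1\<close> once through the linear term
  and twice through the products with \<open>z 1\<close>. By the value of \<open>z 1\<close> the latter contribute
  twice the linear term, so a multiple \<open>beta_coeff ls ls 1\<close> of it remains.
\<close>

lemma coord_z:
  assumes "k \<ge> 2"
  shows "beta_coeff ls ls 1 * coord (z k) ls =
      (\<Sum>m = 1..k - 1. beta_coeff ls ls (k + 1 - m) * coord (z m) ls)
      - (\<Sum>m = 2..k - 1. coord (bprod (beta_star ls) (z (k + 1 - m)) (z m)) ls)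
      - 2 * coord (bprod (beta_star ls) (z 1) (Q_op ls (z k))) ls"
proof -
  let ?B = "\<lambda>m. coord (bprod (beta_star ls) (z (k + 1 - m)) (z m)) ls"
  have "z k = P_op ls (z k) + Q_op ls (z k)"
    by (simp add: Q_op_def)
  then have "bprod (beta_star ls) (z 1) (z k)
     = bprod (beta_star ls) (z 1) (P_op ls (z k)) + bprod (beta_star ls) (z 1) (Q_op ls (z k))"
    by (metis bprod_add_right)
  then have "coord (bprod (beta_star ls) (z 1) (z k)) ls
     = coord (bprod (beta_star ls) (z 1) (P_op ls (z k))) ls
       + coord (bprod (beta_star ls) (z 1) (Q_op ls (z k))) ls"
    by (simp only: lookup_add)
  also have "coord (bprod (beta_star ls) (z 1) (P_op ls (z k))) ls = beta_coeff ls ls 1 * coord (z k) ls"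
  \<comment> \<open>The value of \<open>z 1\<close> is known only for a nonconstant expansion; for a
    constant one both sides are 0.\<close>
  proof (cases "\<exists>k\<ge>1. z k \<noteq> 0")
    case True
    then show ?thesis
      using struct_const_diag_nonzero[of ls]
      by (subst z1_eq) (simp add: P_op_def coord_bprod_kernel coord_z1[OF True, unfolded One_nat_def])
  next
    case False
    then have "z 1 = 0" "z k = 0" using assms by auto
    then show ?thesis by (simp add: bprod_def weighted_prod_def)
  qed
  finally have split: "coord (bprod (beta_star ls) (z 1) (z k)) ls = beta_coeff ls ls 1 * coord (z k) ls
      + coord (bprod (beta_star ls) (z 1) (Q_op ls (z k))) ls" .
  \<comment> \<open>The orders \<open>m = 1\<close> and \<open>m = k\<close>, distinct as
    \<open>k \<ge> 2\<close>, give the products of \<open>z 1\<close> with \<open>z k\<close>. For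
    \<open>k = 2\<close> nothing remains between them.\<close>
  have 1: "{1..k} = insert k {1..k - 1}" and 2: "{1..k} = insert 1 (insert k {2..k - 1})"
    using assms by auto
  have "(\<Sum>m = 1..k. beta_coeff ls ls (k + 1 - m) * coord (z m) ls)
      = beta_coeff ls ls 1 * coord (z k) ls
        + (\<Sum>m = 1..k - 1. beta_coeff ls ls (k + 1 - m) * coord (z m) ls)"
    unfolding 1 using assms by (subst sum.insert) auto
  moreover have "(\<Sum>m = 1..k. ?B m) = ?B 1 + ?B k + (\<Sum>m = 2..k - 1. ?B m)"
    unfolding 2 using assms by (simp add: add.assoc)
  moreover have "?B 1 = ?B k"
    by (simp add: bprod_commute)
  moreover have "?B k = beta_coeff ls ls 1 * coord (z k) ls
      + coord (bprod (beta_star ls) (z 1) (Q_op ls (z k))) ls"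
    using split by simp
  moreover have "k \<ge> 1"
    using assms by simp
  \<comment> \<open>Here \<open>x\<close> is the unknown resonant term and \<open>q\<close> the
    contribution of \<open>Q_op ls (z k)\<close>. Each of the two products is \<open>x + q\<close>,
    so solving for \<open>x\<close> gives \<open>q\<close> the coefficient -2.\<close>
  moreover have "x = S - S' - 2 * q" if "x + S = (x + q) + (x + q) + S'" for x S S' q :: complex
    using that by (simp add: algebra_simps)
  ultimately show ?thesis
    using solvability[of k] by (simp only:)
qed

text \<open>Both sides are multiples of \<open>bvec ls\<close>, so only the coordinate
  \<open>ls\<close> matters, and there the equation may be divided by
  \<open>beta_coeff ls ls 1\<close>.\<close>

lemma P_op_z:
  assumes "k \<ge> 2"
  shows "P_op ls (z k) =
      scal (1 / beta_coeff ls ls 1)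
        ((\<Sum>m = 1..k - 1. scal (beta_coeff ls ls (k + 1 - m)) (P_op ls (z m)))
         - (\<Sum>m = 2..k - 1. P_op ls (bprod (beta_star ls) (z (k + 1 - m)) (z m)))
         - scal 2 (P_op ls (bprod (beta_star ls) (z 1) (Q_op ls (z k)))))" (is "?L = ?R")
proof (rule poly_mapping_eqI)
  fix l
  show "coord ?L l = coord ?R l"
  proof (cases "l = ls")
    case True
    have "coord (z k) ls = 1 / beta_coeff ls ls 1 * (beta_coeff ls ls 1 * coord (z k) ls)"
      using beta_coeff_1_nonzero[OF ls] by simp
    then show ?thesis
      unfolding coord_z[OF assms] by (simp add: True lookup_minus lookup_sum)
  next
    case False
    then show ?thesis by (simp add: lookup_minus lookup_sum)
  qed
qed

end

theorem lemma2p6p1: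
  fixes ls :: nat and z :: "nat \<Rightarrow> balg"
  assumes ls: "2 \<le> ls"
    and z0: "z 0 = bvec 0"
    and fixed_point: "z = eps_bprod (beta_eps ls) z z"
  shows
    "(\<forall>l. (\<lambda>\<epsilon>. inverse (beta_eps ls \<epsilon>) ^ (2 * l)) has_fps_expansion
        fps_const (inverse (beta_star ls) ^ (2 * l)) * Abs_fps (beta_coeff ls l))
     \<and> (\<forall>m. scale_op_coeff (\<lambda>\<epsilon>. inverse (beta_eps ls \<epsilon>)) m
            = scale_op (inverse (beta_star ls)) \<circ> S_coeff ls m)
     \<and> (\<forall>y. y = eps_bprod (beta_eps ls) y y \<longleftrightarrow>
            eps_scale_op (\<lambda>\<epsilon>. inverse (beta_eps ls \<epsilon>)) y = eps_bprod (\<lambda>_. 1) y y)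
     \<and> {x. T_op ls x = 0} = range (\<lambda>c. scal c (bvec ls))
     \<and> T_op ls (z 1) = 0
     \<and> bij_betw (T_op ls) (range (Q_op ls)) (range (Q_op ls))
     \<and> ((\<exists>k\<ge>1. z k \<noteq> 0) \<longrightarrow>
          z 1 = scal (2 * beta_coeff ls ls 1 / struct_const ls ls ls) (bvec ls))
     \<and> (\<forall>k\<ge>1. Q_op ls (z k) =
          T_inv ls (\<Sum>m = 1..k - 1.
            - S_coeff ls (k - m) (Q_op ls (z m))
            + Q_op ls (bprod (beta_star ls) (z (k - m)) (z m))))
     \<and> (\<forall>k\<ge>2. P_op ls (z k) =
          scal (1 / beta_coeff ls ls 1)
            ((\<Sum>m = 1..k - 1. scal (beta_coeff ls ls (k + 1 - m)) (P_op ls (z m)))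
             - (\<Sum>m = 2..k - 1. P_op ls (bprod (beta_star ls) (z (k + 1 - m)) (z m)))
             - scal 2 (P_op ls (bprod (beta_star ls) (z 1) (Q_op ls (z k))))))"
proof -
  interpret eps_fixed_point ls z
    by unfold_locales (fact assms)+
  have kernel: "{x. T_op ls x = 0} = range (\<lambda>c. scal c (bvec ls))"
  proof -
    have "T_op ls (scal c (bvec ls)) = 0" for c
      using T_op_kernel[OF ls, of "scal c (bvec ls)"] by (simp add: coord_bvec)
    then show ?thesis
      using T_op_kernel[OF ls] by auto
  qed
  have iff: "y = eps_bprod (beta_eps ls) y y \<longleftrightarrow>
      eps_scale_op (\<lambda>\<epsilon>. inverse (beta_eps ls \<epsilon>)) y = eps_bprod (\<lambda>_. 1) y y" for y
    by (rule eps_fixed_point_iff) (auto intro!: analytic_intros analytic_beta_eps ls)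
  have z1: "z 1 = scal (2 * beta_coeff ls ls 1 / struct_const ls ls ls) (bvec ls)"
    if "\<exists>k\<ge>1. z k \<noteq> 0"
    using z1_eq coord_z1[OF that] by metis
  show ?thesis
    by (intro conjI allI impI inverse_beta_eps_power_expansion scale_op_coeff_inverse_beta_eps iff
        kernel T_op_z1 bij_betw_T_op z1 Q_op_z P_op_z ls)
qed

end
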